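(* Let $0<\alpha<1$, $h>0$, $T>1$, $c\in\mathbb R$, let $-1\le t_L<t_U\le1$, and let $x\in\mathbb R$ be such that $\lambda:=(x-c)/h\ge t_U$. For $j\ge0$ write $(P_j^{(T)})'(t)=\sum_{r=0}^{j-1}d_{jr}^{(T)}t^r$. Then for every $j\ge 0$ the local Caputo weight of mode $j$, $$W_j^{(\alpha)}=\frac{h^{-\alpha}}{\Gamma(1-\alpha)}\int_{t_L}^{t_U}(\lambda-t)^{-\alpha}(P_j^{(T)})'(t)\,dt,$$ equals the finite sum $$W_j^{(\alpha)}=\frac{h^{-\alpha}}{\Gamma(1-\alpha)}\sum_{r=0}^{j-1}d_{jr}^{(T)}J_r^{(\alpha)}(t_L,t_U;\lambda),\qquad J_r^{(\alpha)}(t_L,t_U;\lambda)=\int_{t_L}^{t_U}(\lambda-t)^{-\alpha}t^r\,dt,$$ and, with $\delta=\lambda-t_U$ and $L=t_U-t_L$, $$J_r^{(\alpha)}(t_L,t_U;\lambda)=\sum_{s=0}^{r}\binom rs t_U^{\,r-s}(-1)^sH_s(\delta,L),\qquad H_s(\delta,L)=\int_0^Ly^s(\delta+y)^{-\alpha}\,dy,$$ where $$H_s(0,L)=\frac{L^{s+1-\alpha}}{s+1-\alpha},\qquad H_s(\delta,L)=\sum_{r=0}^{s}\binom sr(-\delta)^{s-r}\,\frac{(\delta+L)^{r+1-\alpha}-\delta^{r+1-\alpha}}{r+1-\alpha}\quad(\delta>0).$$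
   Context: $P_j^{(T)}(t)=T^{-1/2}p_j(t/T)$, where $\{p_j\}_{j\ge0}$ are the orthonormal Legendre polynomials on $[-1,1]$ ($p_j$ has degree $j$). Empty sums are zero and $0^0=1$. *)

theory Defs
  imports "HOL-Analysis.Analysis" "HOL-Computational_Algebra.Polynomial"
begin

text \<open>Rodrigues' formula; \<open>[:-1, 0, 1:]\<close> is the polynomial \<open>X^2 - 1\<close>.\<close>

definition legendre :: "nat \<Rightarrow> real poly" where
  "legendre j = smult (1 / (2 ^ j * fact j)) ((pderiv ^^ j) ([:-1, 0, 1:] ^ j))"

definition orthonormal_legendre :: "nat \<Rightarrow> real poly" where
  "orthonormal_legendre j = smult (sqrt ((2 * real j + 1) / 2)) (legendre j)"

text \<open>
  The family is characterised up to sign by \<open>degree_orthonormal_legendre\<close> and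
  \<open>orthonormal_legendre\<close> below; the sign is fixed by
  \<open>lead_coeff_orthonormal_legendre\<close>.
\<close>

lemma degree_x2m1: "degree ([:-1, 0, 1:] ^ n :: real poly) = 2 * n"
  by (subst degree_power_eq) auto

lemma degree_orthonormal_legendre: "degree (orthonormal_legendre j) = j"
proof -
  have "sqrt ((2 * real j + 1) / 2) \<noteq> 0" by auto
  then show ?thesis
    unfolding orthonormal_legendre_def legendre_def
    by (simp add: degree_higher_pderiv degree_x2m1 del: real_sqrt_eq_zero_cancel_iff)
qed

lemma coeff_iter_pderiv: "coeff ((pderiv ^^ k) (q :: real poly)) m = fact (m + k) / fact m * coeff q (m + k)"
proof (induction k arbitrary: m)
  case (Suc k)
  have "coeff ((pderiv ^^ Suc k) q) m = real (Suc m) * (fact (Suc m + k) / fact (Suc m) * coeff q (Suc m + k))"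
    by (simp add: coeff_pderiv Suc)
  also have "\<dots> = (real (Suc m) / fact (Suc m)) * fact (m + Suc k) * coeff q (m + Suc k)"
    by simp
  also have "real (Suc m) / fact (Suc m) = 1 / fact m"
    by (simp del: of_nat_Suc)
  finally show ?case by simp
qed simp

lemma lead_coeff_x2m1: "coeff ([:-1, 0, 1:] ^ n :: real poly) (2 * n) = 1"
  using lead_coeff_power[of "[:-1, 0, 1:] :: real poly" n] by (simp add: degree_x2m1)

lemma lead_coeff_orthonormal_legendre: "lead_coeff (orthonormal_legendre j) > 0"
  unfolding degree_orthonormal_legendre
  by (simp add: orthonormal_legendre_def legendre_def coeff_iter_pderiv lead_coeff_x2m1 flip: mult_2)

lemma integral_pderiv:
  "((\<lambda>x. poly (pderiv f) x) has_integral (poly f 1 - poly f (-1))) {-1..1::real}"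
  by (rule fundamental_theorem_of_calculus)
     (auto simp: has_real_derivative_iff_has_vector_derivative[symmetric]
       intro: DERIV_subset[OF poly_DERIV])

lemma poly_integrable: "poly (f :: real poly) integrable_on {a..b}"
  by (rule integrable_continuous_interval) (auto intro: continuous_intros)

lemma poly_mult_fun: "poly (f * g :: real poly) = (\<lambda>x. poly f x * poly g x)"
  by auto

lemma poly_0_fun: "poly (0 :: real poly) = (\<lambda>x. 0)"
  by auto

lemma poly_smult_fun: "poly (smult c f :: real poly) = (\<lambda>x. c * poly f x)"
  by auto

lemma by_parts:
  fixes f g :: "real poly"
  assumes "poly g 1 = 0" "poly g (-1) = 0"
  shows "integral {-1..1} (poly (f * pderiv g)) = - integral {-1..1} (poly (pderiv f * g))"
proof -
  have "integral {-1..1} (poly (pderiv (f * g))) = 0"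
    using integral_unique[OF integral_pderiv[of "f * g"]] assms by simp
  moreover have "poly (pderiv (f * g)) = (\<lambda>x. poly (f * pderiv g) x + poly (pderiv f * g) x)"
    by (auto simp: pderiv_mult algebra_simps)
  ultimately show ?thesis
    using integral_add[OF poly_integrable[of "f * pderiv g"] poly_integrable[of "pderiv f * g"]]
    by (simp only:) 
qed

lemma dvd_pderiv: "(a :: real poly) ^ Suc m dvd f \<Longrightarrow> a ^ m dvd pderiv f"
proof (elim dvdE)
  fix k assume "f = a ^ Suc m * k"
  then have "pderiv f = a ^ m * (a * pderiv k + smult (of_nat (Suc m)) (pderiv a) * k)"
    by (simp only: pderiv_mult pderiv_power_Suc) (simp add: algebra_simps)
  then show "a ^ m dvd pderiv f" by simp
qed

lemma dvd_pderiv_iter: "k \<le> n \<Longrightarrow> (a :: real poly) ^ (n - k) dvd (pderiv ^^ k) (a ^ n)"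
proof (induction k)
  case (Suc k)
  then have "a ^ Suc (n - Suc k) dvd (pderiv ^^ k) (a ^ n)"
    by (simp add: Suc_diff_Suc del: power_Suc)
  then show ?case using dvd_pderiv by auto
qed auto

lemma boundary:
  assumes "k < n" "x = 1 \<or> x = -1"
  shows "poly ((pderiv ^^ k) ([:-1, 0, 1:] ^ n)) (x :: real) = 0"
proof -
  have "[:-1, 0, 1 :: real:] dvd [:-1, 0, 1:] ^ (n - k)"
    using assms by (intro dvd_power) auto
  also have "\<dots> dvd (pderiv ^^ k) ([:-1, 0, 1:] ^ n)"
    using assms by (intro dvd_pderiv_iter) auto
  finally obtain q :: "real poly" where "(pderiv ^^ k) ([:-1, 0, 1:] ^ n) = [:-1, 0, 1:] * q"
    by (elim dvdE)
  then show ?thesis using assms by auto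
qed

lemma by_parts_iter:
  fixes f :: "real poly"
  assumes "k \<le> n"
  shows "integral {-1..1} (poly (f * (pderiv ^^ n) ([:-1, 0, 1:] ^ n)))
    = (-1) ^ k * integral {-1..1} (poly ((pderiv ^^ k) f * (pderiv ^^ (n - k)) ([:-1, 0, 1:] ^ n)))"
  using assms
proof (induction k)
  case (Suc k)
  then have eq: "(pderiv ^^ (n - k)) ([:-1, 0, 1:] ^ n :: real poly)
      = pderiv ((pderiv ^^ (n - Suc k)) ([:-1, 0, 1:] ^ n))"
    by (simp add: Suc_diff_Suc flip: funpow.simps(2) comp_apply[of pderiv])
  have "integral {-1..1} (poly ((pderiv ^^ k) f * pderiv ((pderiv ^^ (n - Suc k)) ([:-1, 0, 1:] ^ n))))
    = - integral {-1..1} (poly (pderiv ((pderiv ^^ k) f) * (pderiv ^^ (n - Suc k)) ([:-1, 0, 1:] ^ n)))"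
    using Suc.prems by (intro by_parts boundary) auto
  then show ?case using Suc by (simp only: eq power_Suc) (simp add: poly_mult_fun del: poly_mult)
qed simp

lemma legendre_orth_lt:
  assumes "i < j"
  shows "integral {-1..1} (poly (legendre i * legendre j)) = 0"
proof -
  have d: "degree (legendre i) < j"
    using assms by (simp add: legendre_def degree_higher_pderiv degree_x2m1)
  have "(pderiv ^^ j) (legendre i) = 0"
    by (rule poly_eqI) (use d in \<open>simp add: coeff_iter_pderiv coeff_eq_0\<close>)
  then have "integral {-1..1} (poly (legendre i * (pderiv ^^ j) ([:-1, 0, 1:] ^ j))) = 0"
    using by_parts_iter[OF order_refl, of "legendre i" j]
    by (simp only: mult_zero_left poly_0_fun integral_0 mult_zero_right)
  then show ?thesis
    by (subst (2) legendre_def) (simp add: poly_smult_fun flip: poly_mult_fun)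
qed

lemma integral_x2m1_rec:
  "(2 * real n + 3) * integral {-1..1} (poly ([:-1, 0, 1:] ^ Suc n))
    = - (2 * real n + 2) * integral {-1..1} (poly ([:-1, 0, 1:] ^ n))"
proof -
  let ?a = "[:-1, 0, 1 :: real:]"
  have "integral {-1..1} (poly (pderiv ([:0, 1:] * ?a ^ Suc n))) = 0"
    using integral_unique[OF integral_pderiv[of "[:0, 1:] * ?a ^ Suc n"]] by simp
  moreover have "poly (pderiv ([:0, 1:] * ?a ^ Suc n)) =
     (\<lambda>x. (2 * real n + 3) * poly (?a ^ Suc n) x + (2 * real n + 2) * poly (?a ^ n) x)"
  proof
    fix x
    have "poly (pderiv ([:0, 1:] * ?a ^ Suc n)) x
      = x * (real (Suc n) * (x\<^sup>2 - 1) ^ n * (2 * x)) + (x\<^sup>2 - 1) ^ Suc n"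
      by (simp only: pderiv_mult pderiv_power_Suc poly_add poly_mult poly_power poly_smult)
         (simp add: pderiv_pCons power2_eq_square)
    moreover have "poly ?a x = x\<^sup>2 - 1" by (simp add: power2_eq_square)
    ultimately show "poly (pderiv ([:0, 1:] * ?a ^ Suc n)) x
      = (2 * real n + 3) * poly (?a ^ Suc n) x + (2 * real n + 2) * poly (?a ^ n) x"
      by (simp only: poly_power) (simp add: algebra_simps power2_eq_square)
  qed
  ultimately have "0 = integral {-1..1} (\<lambda>x. (2 * real n + 3) * poly (?a ^ Suc n) x + (2 * real n + 2) * poly (?a ^ n) x)"
    by (simp only:)
  also have "\<dots> = (2 * real n + 3) * integral {-1..1} (poly (?a ^ Suc n)) + (2 * real n + 2) * integral {-1..1} (poly (?a ^ n))"
    by (subst integral_add) (simp_all only: poly_integrable integrable_on_mult_right integral_mult_right)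
  finally show ?thesis by linarith
qed

lemma integral_x2m1:
  "integral {-1..1} (poly ([:-1, 0, 1:] ^ n)) = (-1) ^ n * 2 ^ (2 * n + 1) * (fact n)\<^sup>2 / (fact (2 * n + 1) :: real)"
proof (induction n)
  case (Suc n)
  define F :: real where "F = fact (2 * n + 1)"
  have F: "F \<noteq> 0" "fact (2 * Suc n + 1) = (2 * real n + 3) * (2 * real n + 2) * F"
  proof -
    show "F \<noteq> 0" unfolding F_def by (rule fact_nonzero)
    have "2 * Suc n + 1 = Suc (Suc (2 * n + 1))" by simp
    then show "fact (2 * Suc n + 1) = (2 * real n + 3) * (2 * real n + 2) * F"
      unfolding F_def by (simp only: fact_Suc) (simp add: add.commute)
  qed
  have G: "fact (Suc n) = (real n + 1) * fact n" by (simp add: algebra_simps)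
  have "2 * real n + 3 \<noteq> 0" by linarith
  then have *: "X = - a / (2 * real n + 3) * Y" if "(2 * real n + 3) * X = - a * Y" for X Y a
    using that by (simp add: divide_simps mult.commute)
  have "integral {-1..1} (poly ([:-1, 0, 1 :: real:] ^ Suc n))
     = - (2 * real n + 2) / (2 * real n + 3) * integral {-1..1} (poly ([:-1, 0, 1:] ^ n))"
    using integral_x2m1_rec[of n] by (rule *)
  also have "\<dots> = - (2 * real n + 2) / (2 * real n + 3) * ((-1) ^ n * 2 ^ (2 * n + 1) * (fact n)\<^sup>2 / F)"
    unfolding Suc F_def ..
  also have "\<dots> = (-1) ^ Suc n * 2 ^ (2 * Suc n + 1) * ((real n + 1) * fact n)\<^sup>2 / ((2 * real n + 3) * (2 * real n + 2) * F)"
  proof -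
    have gen: "- a / b * (s * P * f\<^sup>2 / F) = (- s) * (4 * P) * ((a / 2) * f)\<^sup>2 / (b * a * F)"
      if "a \<noteq> 0" for a b s P f :: real
      using that by (simp add: power2_eq_square)
    have *: "2 * real n + 2 \<noteq> 0" "(2 * real n + 2) / 2 = real n + 1"
      "(- 1 :: real) ^ Suc n = - ((- 1) ^ n)" "(2 :: real) ^ (2 * Suc n + 1) = 4 * 2 ^ (2 * n + 1)"
      by auto
    show ?thesis using gen[OF *(1), of "2 * real n + 3" "(-1) ^ n" "2 ^ (2 * n + 1)" "fact n"]
      unfolding * .
  qed
  finally show ?case by (simp only: F(2) G)
next
  case 0
  have "poly (1 :: real poly) = (\<lambda>x. 1)" by auto
  then show ?case by simp
qed

lemma legendre_norm: "integral {-1..1} (poly (legendre j * legendre j)) = 2 / (2 * real j + 1)"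
proof -
  let ?w = "[:-1, 0, 1 :: real:] ^ j" and ?c = "1 / (2 ^ j * fact j :: real)"
  have const: "(pderiv ^^ j) ((pderiv ^^ j) ?w) = [:fact (2 * j):]"
  proof (rule poly_eqI)
    fix m
    have c: "coeff ((pderiv ^^ j) ((pderiv ^^ j) ?w)) m
        = fact (m + j) / fact m * (fact (m + j + j) / fact (m + j) * coeff ?w (m + j + j))"
      by (simp only: coeff_iter_pderiv)
    show "coeff ((pderiv ^^ j) ((pderiv ^^ j) ?w)) m = coeff [:fact (2 * j):] m"
    proof (cases m)
      case 0
      have "j + j = 2 * j" by simp
      with 0 lead_coeff_x2m1[of j] have "coeff ?w (m + j + j) = 1" "m + j + j = 2 * j"
        by (simp_all only: add_0)
      then show ?thesis unfolding c by (simp add: 0 mult_2)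
    next
      case (Suc k)
      then have "coeff ?w (m + j + j) = 0"
        by (intro coeff_eq_0) (simp add: degree_x2m1)
      then show ?thesis unfolding c using Suc by simp
    qed
  qed
  have "integral {-1..1} (poly ((pderiv ^^ j) ?w * (pderiv ^^ j) ?w)) = (-1) ^ j * (fact (2 * j) * integral {-1..1} (poly ?w))"
    unfolding by_parts_iter[OF order_refl] const
    by (simp only: diff_self_eq_0 funpow_0 mult_pCons_left mult_zero_left pCons_0_0 add_0_right
      poly_smult_fun integral_mult_right)
  also have "\<dots> = fact (2 * j) * 2 ^ (2 * j + 1) * (fact j)\<^sup>2 / fact (2 * j + 1)"
  proof -
    have "(-1) ^ j * (-1) ^ j = (1 :: real)" by (simp flip: power_mult_distrib)
    moreover have "m * (A * (m * P * Q / B)) = (m * m) * (A * P * Q / B)" for m A P Q B :: real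
      by (simp add: mult.assoc mult.left_commute)
    ultimately show ?thesis unfolding integral_x2m1 by (simp only: mult_1)
  qed
  finally have *: "integral {-1..1} (poly ((pderiv ^^ j) ?w * (pderiv ^^ j) ?w)) = \<dots>" .
  have "legendre j * legendre j = smult (?c * ?c) ((pderiv ^^ j) ?w * (pderiv ^^ j) ?w)"
    unfolding legendre_def by simp
  then have "integral {-1..1} (poly (legendre j * legendre j)) = ?c * ?c * (fact (2 * j) * 2 ^ (2 * j + 1) * (fact j)\<^sup>2 / fact (2 * j + 1))"
    by (simp only: poly_smult_fun integral_mult_right *)
  also have "\<dots> = 2 / (2 * real j + 1)"
  proof -
    have F: "fact (2 * j + 1) = (2 * real j + 1) * fact (2 * j)" by (simp add: algebra_simps)
    have P: "(2::real) ^ (2 * j + 1) = 2 * (2 ^ j * 2 ^ j)" by (simp only: mult_2 power_add) simp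
    have gen: "1 / (p * f) * (1 / (p * f)) * (g * (2 * (p * p)) * (f * f) / (d * g)) = 2 / d"
      if "p \<noteq> 0" "f \<noteq> 0" "g \<noteq> 0" for p f g d :: real
      using that by simp
    show ?thesis unfolding F P power2_eq_square by (rule gen) auto
  qed
  finally show ?thesis .
qed

lemma orthonormal_legendre:
  "integral {-1..1} (\<lambda>t. poly (orthonormal_legendre i) t * poly (orthonormal_legendre j) t)
    = (if i = j then 1 else 0)"
proof -
  have "integral {-1..1} (\<lambda>t. poly (legendre i) t * poly (legendre j) t) = (if i = j then 2 / (2 * real j + 1) else 0)"
    using legendre_norm[of j] legendre_orth_lt[of i j] legendre_orth_lt[of j i]
    unfolding poly_mult_fun
    by (cases i j rule: linorder_cases) (simp_all add: mult.commute)
  moreover have "(\<lambda>t. poly (orthonormal_legendre i) t * poly (orthonormal_legendre j) t)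
    = (\<lambda>t. (sqrt ((2 * real i + 1) / 2) * sqrt ((2 * real j + 1) / 2)) * (poly (legendre i) t * poly (legendre j) t))"
    by (auto simp: orthonormal_legendre_def)
  ultimately show ?thesis by simp
qed

definition legendre_scaled :: "real \<Rightarrow> nat \<Rightarrow> real poly" where
  "legendre_scaled T j = smult (T powr (-1/2)) (orthonormal_legendre j \<circ>\<^sub>p [:0, 1 / T:])"

lemma poly_legendre_scaled:
  "poly (legendre_scaled T j) t = T powr (-1/2) * poly (orthonormal_legendre j) (t / T)"
  by (simp add: legendre_scaled_def poly_pcompose)

definition legendre_deriv_coeff :: "real \<Rightarrow> nat \<Rightarrow> nat \<Rightarrow> real" where
  "legendre_deriv_coeff T j r = coeff (pderiv (legendre_scaled T j)) r"

text \<open>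
  The integrand may be singular at \<open>t\<^sub>U\<close> (when \<open>lam = t\<^sub>U\<close>); there
  \<open>0 powr (-\<alpha>) = 0\<close>, which affects the integral only on a null set.
\<close>

definition caputo_weight ::
    "real \<Rightarrow> real \<Rightarrow> real \<Rightarrow> real \<Rightarrow> real \<Rightarrow> real \<Rightarrow> nat \<Rightarrow> real" where
  "caputo_weight \<alpha> h T t\<^sub>L t\<^sub>U lam j =
     h powr (-\<alpha>) / Gamma (1 - \<alpha>) *
     integral {t\<^sub>L..t\<^sub>U} (\<lambda>t. (lam - t) powr (-\<alpha>) * deriv (poly (legendre_scaled T j)) t)"

definition J_int :: "real \<Rightarrow> nat \<Rightarrow> real \<Rightarrow> real \<Rightarrow> real \<Rightarrow> real" where
  "J_int \<alpha> r t\<^sub>L t\<^sub>U lam = integral {t\<^sub>L..t\<^sub>U} (\<lambda>t. (lam - t) powr (-\<alpha>) * t ^ r)"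

definition H_int :: "real \<Rightarrow> nat \<Rightarrow> real \<Rightarrow> real \<Rightarrow> real" where
  "H_int \<alpha> s \<delta> L = integral {0..L} (\<lambda>y. y ^ s * (\<delta> + y) powr (-\<alpha>))"

end

theory Submission
  imports Defs
begin

text \<open>
  The substitution \<open>t = t\<^sub>U - y\<close> and a binomial expansion of \<open>(t\<^sub>U - y)\<^sup>r\<close> reduce \<open>J\<close> to \<open>H\<close>;
  expanding \<open>y\<^sup>s = ((\<delta> + y) - \<delta>)\<^sup>s\<close> reduces \<open>H\<close> to integrals of \<open>(\<delta> + y) powr a\<close> with
  \<open>a > -1\<close>, whose primitive \<open>(\<delta> + y) powr (a + 1) / (a + 1)\<close> stays continuous even where
  the integrand is singular, at \<open>\<delta> + y = 0\<close>.
\<close>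

text \<open>The range is governed by a degree bound instead of the exact degree, so the sum can run
  over \<open>r < j\<close> for every mode; coefficients beyond the degree vanish.\<close>

lemma deriv_poly_eq_sum:
  fixes p :: "real poly"
  assumes "degree p \<le> n"
  shows "deriv (poly p) t = (\<Sum>r<n. coeff (pderiv p) r * t ^ r)"
proof -
  have "deriv (poly p) t = poly (pderiv p) t"
    by (intro DERIV_imp_deriv poly_DERIV)
  also have "\<dots> = (\<Sum>r\<le>degree (pderiv p). coeff (pderiv p) r * t ^ r)"
    by (rule poly_altdef)
  also have "\<dots> = (\<Sum>r<n. coeff (pderiv p) r * t ^ r)"
  proof (rule sum.mono_neutral_cong)
    \<comment> \<open>Such an \<open>r\<close> exists only for \<open>n = 0\<close>: the left sum
      still has the index 0 because \<open>degree (pderiv p)\<close> is then 0, while the right sum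
      is empty.\<close>
    fix r assume "r \<in> {..degree (pderiv p)} - {..<n}"
    then have "degree p < Suc r" using assms by auto
    then show "coeff (pderiv p) r * t ^ r = 0"
      by (simp add: coeff_pderiv coeff_eq_0)
  qed (auto simp: coeff_eq_0)
  finally show ?thesis .
qed

lemma degree_legendre_scaled_le: "degree (legendre_scaled T j) \<le> j"
  by (simp add: legendre_scaled_def degree_pcompose degree_orthonormal_legendre)

lemma deriv_legendre_scaled:
  "deriv (poly (legendre_scaled T j)) t = (\<Sum>r<j. legendre_deriv_coeff T j r * t ^ r)"
  unfolding legendre_deriv_coeff_def
  by (rule deriv_poly_eq_sum[OF degree_legendre_scaled_le])

lemma has_integral_shifted_powr:
  fixes a \<delta> L :: real
  assumes "-1 < a" "0 \<le> \<delta>" "0 \<le> L"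
  shows "((\<lambda>y. (\<delta> + y) powr a) has_integral
    (((\<delta> + L) powr (a + 1) - \<delta> powr (a + 1)) / (a + 1))) {0..L}"
proof -
  have "((\<lambda>y. (\<delta> + y) powr a) has_integral
    ((\<delta> + L) powr (a + 1) / (a + 1) - (\<delta> + 0) powr (a + 1) / (a + 1))) {0..L}"
  \<comment> \<open>This version asks for the derivative only on the open interval, where
    \<open>\<delta> + y > 0\<close>; at the endpoints continuity of the primitive suffices, and
    \<open>a + 1 > 0\<close> gives it even at the base 0.\<close>
  proof (rule fundamental_theorem_of_calculus_interior)
    show "continuous_on {0..L} (\<lambda>y. (\<delta> + y) powr (a + 1) / (a + 1))"
      using assms by (intro continuous_intros continuous_on_powr') auto
    fix y assume "y \<in> {0<..<L}"
    then show "((\<lambda>y. (\<delta> + y) powr (a + 1) / (a + 1)) has_vector_derivative (\<delta> + y) powr a) (at y)"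
      unfolding has_real_derivative_iff_has_vector_derivative[symmetric]
      using assms by (auto intro!: derivative_eq_intros)
  qed (use assms in auto)
  then show ?thesis by (simp add: diff_divide_distrib)
qed

text \<open>Affine substitution with slope -1, whose Jacobian factor is 1. The map is an involution,
  so the same substitution gives both directions.\<close>

lemma has_integral_reflect_to_0:
  fixes f :: "real \<Rightarrow> real"
  assumes "a \<le> b"
  shows "((\<lambda>y. f (b - y)) has_integral i) {0..b - a} \<longleftrightarrow> (f has_integral i) {a..b}"
proof
  assume "(f has_integral i) {a..b}"
  then have "((\<lambda>y. f (- 1 *\<^sub>R y + b)) has_integral i)
      ((\<lambda>y. (1 / - 1) *\<^sub>R y + - ((1 / - 1) *\<^sub>R b)) ` {a..b})"
    using has_integral_affinity[of f i a b "-1" b] by simp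
  moreover have "(\<lambda>y. (1 / - 1) *\<^sub>R y + - ((1 / - 1) *\<^sub>R b)) ` {a..b} = {0..b - a}"
    using assms image_affinity_atLeastAtMost[of "-1" b a b] by simp
  ultimately show "((\<lambda>y. f (b - y)) has_integral i) {0..b - a}" by simp
next
  assume "((\<lambda>y. f (b - y)) has_integral i) {0..b - a}"
  then have "((\<lambda>y. f (b - (- 1 *\<^sub>R y + b))) has_integral i)
      ((\<lambda>y. (1 / - 1) *\<^sub>R y + - ((1 / - 1) *\<^sub>R b)) ` {0..b - a})"
    using has_integral_affinity[of "\<lambda>y. f (b - y)" i 0 "b - a" "-1" b] by simp
  moreover have "(\<lambda>y. (1 / - 1) *\<^sub>R y + - ((1 / - 1) *\<^sub>R b)) ` {0..b - a} = {a..b}"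
    using assms image_affinity_atLeastAtMost[of "-1" b 0 "b - a"] by simp
  ultimately show "(f has_integral i) {a..b}" by simp
qed

text \<open>The equivalence for every value \<open>i\<close> makes both integrability and the chosen
  value agree, so the identity also covers non-integrable \<open>f\<close>, where both sides are 0
  by convention.\<close>

lemma integral_reflect_to_0:
  fixes f :: "real \<Rightarrow> real"
  assumes "a \<le> b"
  shows "integral {a..b} f = integral {0..b - a} (\<lambda>y. f (b - y))"
  unfolding integral_def integrable_on_def has_integral_reflect_to_0[OF assms] ..

text \<open>Here \<open>f\<close> carries the possible singularity: its sign upgrades integrability
  to absolute integrability, which survives multiplication by \<open>g\<close>, bounded and
  measurable on a compact interval.\<close>

lemma absolutely_integrable_nonneg_mult_continuous:
  fixes f g :: "real \<Rightarrow> real"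
  assumes "f integrable_on {a..b}" "\<And>t. t \<in> {a..b} \<Longrightarrow> 0 \<le> f t" "continuous_on {a..b} g"
  shows "(\<lambda>t. f t * g t) absolutely_integrable_on {a..b}"
proof -
  have "(\<lambda>t. g t * f t) absolutely_integrable_on {a..b}"
  proof (rule absolutely_integrable_bounded_measurable_product_real)
    show "g \<in> borel_measurable (lebesgue_on {a..b})"
      using assms(3) by (intro continuous_imp_measurable_on_sets_lebesgue) auto
    show "bounded (g ` {a..b})"
      using assms(3) by (intro compact_imp_bounded compact_continuous_image) auto
    show "f absolutely_integrable_on {a..b}"
      using assms(1,2) by (rule nonnegative_absolutely_integrable_1)
  qed auto
  then show ?thesis by (simp add: mult.commute)
qed

lemma absolutely_integrable_powr_mult:
  fixes \<alpha> a b lam :: real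
  assumes "\<alpha> < 1" "a \<le> b" "b \<le> lam" "continuous_on {a..b} g"
  shows "(\<lambda>t. (lam - t) powr (-\<alpha>) * g t) absolutely_integrable_on {a..b}"
proof (rule absolutely_integrable_nonneg_mult_continuous)
  \<comment> \<open>Reflection at \<open>b\<close> turns the kernel into a shifted power with shift
    \<open>lam - b\<close>, nonnegative, and exponent above -1.\<close>
  have "(\<lambda>y. ((lam - b) + y) powr (-\<alpha>)) integrable_on {0..b - a}"
    using assms has_integral_shifted_powr[of "-\<alpha>" "lam - b" "b - a"]
    by (auto simp: integrable_on_def)
  then show "(\<lambda>t. (lam - t) powr (-\<alpha>)) integrable_on {a..b}"
    unfolding integrable_on_def has_integral_reflect_to_0[OF assms(2), symmetric]
    by (simp add: algebra_simps)
qed (use assms in auto)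

lemma absolutely_integrable_power_mult_powr:
  fixes \<alpha> \<delta> L :: real
  assumes "\<alpha> < 1" "0 \<le> \<delta>" "0 \<le> L"
  shows "(\<lambda>y. y ^ s * (\<delta> + y) powr (-\<alpha>)) absolutely_integrable_on {0..L}"
proof -
  have "(\<lambda>y. (\<delta> + y) powr (-\<alpha>) * y ^ s) absolutely_integrable_on {0..L}"
    using assms has_integral_shifted_powr[of "-\<alpha>" \<delta> L]
    by (intro absolutely_integrable_nonneg_mult_continuous continuous_intros)
      (auto simp: integrable_on_def)
  then show ?thesis by (simp add: mult.commute)
qed

text \<open>At \<open>u = 0\<close> both sides are 0, because \<open>0 powr e\<close> is 0 for every
  \<open>e\<close>; this holds even for \<open>r = 0\<close>, where \<open>u ^ r\<close> is
  1.\<close>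

lemma power_mult_powr:
  fixes u a :: real
  assumes "0 \<le> u"
  shows "u ^ r * u powr a = u powr (real r + a)"
  using assms by (cases "u = 0") (auto simp: powr_add powr_realpow)

lemma H_int_0:
  assumes "\<alpha> < 1" "0 \<le> L"
  shows "H_int \<alpha> s 0 L = L powr (real s + 1 - \<alpha>) / (real s + 1 - \<alpha>)"
proof -
  \<comment> \<open>With zero shift the integrand is a single power; \<open>0 + y\<close> is kept to
    match the shifted-power integral.\<close>
  have "H_int \<alpha> s 0 L = integral {0..L} (\<lambda>y. (0 + y) powr (real s - \<alpha>))"
    unfolding H_int_def
    by (intro integral_cong) (use power_mult_powr[of _ s "-\<alpha>"] in auto)
  also have "\<dots> = L powr (real s + 1 - \<alpha>) / (real s + 1 - \<alpha>)"
    using has_integral_shifted_powr[of "real s - \<alpha>" 0 L] assms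
    by (intro integral_unique) (simp add: algebra_simps)
  finally show ?thesis .
qed

text \<open>At \<open>\<delta> = 0\<close> the factor \<open>(-\<delta>) ^ (s - r)\<close> kills
  every term except \<open>r = s\<close>, which leaves the closed form of
  \<open>H_int_0\<close>.\<close>

lemma H_int_nonneg:
  assumes "\<alpha> < 1" "0 \<le> \<delta>" "0 \<le> L"
  shows "H_int \<alpha> s \<delta> L = (\<Sum>r\<le>s. real (s choose r) * (-\<delta>) ^ (s - r) *
    (((\<delta> + L) powr (real r + 1 - \<alpha>) - \<delta> powr (real r + 1 - \<alpha>)) / (real r + 1 - \<alpha>)))"
  unfolding H_int_def
proof (rule integral_unique)
  have "((\<lambda>y. (\<Sum>r\<le>s. real (s choose r) * (-\<delta>) ^ (s - r) * (\<delta> + y) powr (real r - \<alpha>))) has_integral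
    (\<Sum>r\<le>s. real (s choose r) * (-\<delta>) ^ (s - r) *
    (((\<delta> + L) powr (real r - \<alpha> + 1) - \<delta> powr (real r - \<alpha> + 1)) / (real r - \<alpha> + 1)))) {0..L}"
    using assms
    by (intro has_integral_sum has_integral_mult_right has_integral_shifted_powr) auto
  moreover have "(\<Sum>r\<le>s. real (s choose r) * (-\<delta>) ^ (s - r) * (\<delta> + y) powr (real r - \<alpha>))
      = y ^ s * (\<delta> + y) powr (-\<alpha>)" if "y \<in> {0..L}" for y
  proof -
    have "y ^ s * (\<delta> + y) powr (-\<alpha>) = ((\<delta> + y) + (-\<delta>)) ^ s * (\<delta> + y) powr (-\<alpha>)" by simp
    also have "\<dots> = (\<Sum>r\<le>s. real (s choose r) * (-\<delta>) ^ (s - r) * ((\<delta> + y) ^ r * (\<delta> + y) powr (-\<alpha>)))"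
      unfolding binomial_ring[of "\<delta> + y" "-\<delta>" s] sum_distrib_right by (simp only: mult_ac)
    also have "\<dots> = (\<Sum>r\<le>s. real (s choose r) * (-\<delta>) ^ (s - r) * (\<delta> + y) powr (real r - \<alpha>))"
      using assms that by (simp add: power_mult_powr)
    finally show ?thesis ..
  qed
  ultimately show "((\<lambda>y. y ^ s * (\<delta> + y) powr (-\<alpha>)) has_integral
    (\<Sum>r\<le>s. real (s choose r) * (-\<delta>) ^ (s - r) *
    (((\<delta> + L) powr (real r + 1 - \<alpha>) - \<delta> powr (real r + 1 - \<alpha>)) / (real r + 1 - \<alpha>)))) {0..L}"
    by (subst has_integral_cong[where g = "\<lambda>y. \<Sum>r\<le>s. real (s choose r) * (-\<delta>) ^ (s - r) * (\<delta> + y) powr (real r - \<alpha>)"])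
      (simp_all add: algebra_simps)
qed

lemma J_int_eq_sum_H_int:
  assumes "\<alpha> < 1" "a \<le> b" "b \<le> lam"
  shows "J_int \<alpha> r a b lam =
    (\<Sum>s\<le>r. real (r choose s) * b ^ (r - s) * (-1) ^ s * H_int \<alpha> s (lam - b) (b - a))"
proof -
  \<comment> \<open>The identity holds for every \<open>y\<close>, including the singular point, so
    it can be rewritten under the integral.\<close>
  have expand: "(lam - (b - y)) powr (-\<alpha>) * (b - y) ^ r =
      (\<Sum>s\<le>r. real (r choose s) * b ^ (r - s) * (-1) ^ s * (y ^ s * ((lam - b) + y) powr (-\<alpha>)))" for y
  proof -
    have "(b - y) ^ r = (\<Sum>s\<le>r. real (r choose s) * (- y) ^ s * b ^ (r - s))"
      using binomial_ring[of "- y" b r] by simp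
    moreover have "lam - (b - y) = (lam - b) + y" by simp
    ultimately show ?thesis
      by (simp only: sum_distrib_left power_minus[of y] mult_ac)
  qed
  have "J_int \<alpha> r a b lam = integral {0..b - a} (\<lambda>y. \<Sum>s\<le>r. real (r choose s) * b ^ (r - s) * (-1) ^ s *
      (y ^ s * ((lam - b) + y) powr (-\<alpha>)))"
    unfolding J_int_def integral_reflect_to_0[OF assms(2)] expand ..
  also have "\<dots> = (\<Sum>s\<le>r. integral {0..b - a} (\<lambda>y. real (r choose s) * b ^ (r - s) * (-1) ^ s *
      (y ^ s * ((lam - b) + y) powr (-\<alpha>))))"
    using assms
    \<comment> \<open>Exchanging sum and integral needs each summand integrable, which absolute
      integrability supplies.\<close>
    by (intro integral_sum integrable_on_mult_right set_lebesgue_integral_eq_integral(1)[OF absolutely_integrable_power_mult_powr]) auto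
  finally show ?thesis by (simp only: integral_mult_right H_int_def)
qed

lemma caputo_weight_eq_sum_J_int:
  assumes "\<alpha> < 1" "a \<le> b" "b \<le> lam"
  shows "caputo_weight \<alpha> h T a b lam j =
    h powr (-\<alpha>) / Gamma (1 - \<alpha>) * (\<Sum>r<j. legendre_deriv_coeff T j r * J_int \<alpha> r a b lam)"
proof -
  have "integral {a..b} (\<lambda>t. (lam - t) powr (-\<alpha>) * deriv (poly (legendre_scaled T j)) t)
      = integral {a..b} (\<lambda>t. \<Sum>r<j. legendre_deriv_coeff T j r * ((lam - t) powr (-\<alpha>) * t ^ r))"
    unfolding deriv_legendre_scaled sum_distrib_left by (simp only: mult_ac)
  also have "\<dots> = (\<Sum>r<j. integral {a..b} (\<lambda>t. legendre_deriv_coeff T j r * ((lam - t) powr (-\<alpha>) * t ^ r)))"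
    using assms
    by (intro integral_sum integrable_on_mult_right
        set_lebesgue_integral_eq_integral(1)[OF absolutely_integrable_powr_mult] continuous_intros) auto
  finally show ?thesis
    by (simp only: caputo_weight_def J_int_def integral_mult_right)
qed

text \<open>Since \<open>integral\<close> returns 0 on non-integrable functions, the absolute
  integrability conjuncts certify that the integrals are genuine, also in the singular case
  \<open>lam = t\<^sub>U\<close>.\<close>

theorem mainTheorem5:
  fixes \<alpha> h T c t\<^sub>L t\<^sub>U x lam \<delta> L :: real
  assumes "0 < \<alpha>" "\<alpha> < 1" "h > 0" "T > 1"
    and "-1 \<le> t\<^sub>L" "t\<^sub>L < t\<^sub>U" "t\<^sub>U \<le> 1"
    and "lam = (x - c) / h" "lam \<ge> t\<^sub>U"
    and "\<delta> = lam - t\<^sub>U" "L = t\<^sub>U - t\<^sub>L"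
  shows
    "(\<forall>j t. deriv (poly (legendre_scaled T j)) t = (\<Sum>r<j. legendre_deriv_coeff T j r * t ^ r)) \<and>
     (\<forall>j. (\<lambda>t. (lam - t) powr (-\<alpha>) * deriv (poly (legendre_scaled T j)) t)
            absolutely_integrable_on {t\<^sub>L..t\<^sub>U} \<and>
          caputo_weight \<alpha> h T t\<^sub>L t\<^sub>U lam j =
            h powr (-\<alpha>) / Gamma (1 - \<alpha>) *
            (\<Sum>r<j. legendre_deriv_coeff T j r * J_int \<alpha> r t\<^sub>L t\<^sub>U lam)) \<and>
     (\<forall>r. (\<lambda>t. (lam - t) powr (-\<alpha>) * t ^ r) absolutely_integrable_on {t\<^sub>L..t\<^sub>U} \<and>
          J_int \<alpha> r t\<^sub>L t\<^sub>U lam =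
            (\<Sum>s\<le>r. real (r choose s) * t\<^sub>U ^ (r - s) * (-1) ^ s * H_int \<alpha> s \<delta> L)) \<and>
     (\<forall>s. (\<lambda>y. y ^ s * (\<delta> + y) powr (-\<alpha>)) absolutely_integrable_on {0..L} \<and>
          H_int \<alpha> s 0 L = L powr (real s + 1 - \<alpha>) / (real s + 1 - \<alpha>) \<and>
          (\<delta> > 0 \<longrightarrow>
             H_int \<alpha> s \<delta> L =
               (\<Sum>r\<le>s. real (s choose r) * (-\<delta>) ^ (s - r) *
                 (((\<delta> + L) powr (real r + 1 - \<alpha>) - \<delta> powr (real r + 1 - \<alpha>)) / (real r + 1 - \<alpha>)))))"
proof (intro conjI allI impI)
  have bounds: "\<alpha> < 1" "t\<^sub>L \<le> t\<^sub>U" "t\<^sub>U \<le> lam" "0 \<le> \<delta>" "0 \<le> L"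
    using assms by auto
  show "deriv (poly (legendre_scaled T j)) t = (\<Sum>r<j. legendre_deriv_coeff T j r * t ^ r)" for j t
    by (rule deriv_legendre_scaled)
  show "(\<lambda>t. (lam - t) powr (-\<alpha>) * deriv (poly (legendre_scaled T j)) t)
      absolutely_integrable_on {t\<^sub>L..t\<^sub>U}" for j
    unfolding deriv_legendre_scaled
    by (intro absolutely_integrable_powr_mult bounds continuous_intros)
  show "(\<lambda>t. (lam - t) powr (-\<alpha>) * t ^ r) absolutely_integrable_on {t\<^sub>L..t\<^sub>U}" for r
    by (intro absolutely_integrable_powr_mult bounds continuous_intros)
  show "caputo_weight \<alpha> h T t\<^sub>L t\<^sub>U lam j = h powr (-\<alpha>) / Gamma (1 - \<alpha>) *
      (\<Sum>r<j. legendre_deriv_coeff T j r * J_int \<alpha> r t\<^sub>L t\<^sub>U lam)" for j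
    by (intro caputo_weight_eq_sum_J_int bounds)
  show "J_int \<alpha> r t\<^sub>L t\<^sub>U lam =
      (\<Sum>s\<le>r. real (r choose s) * t\<^sub>U ^ (r - s) * (-1) ^ s * H_int \<alpha> s \<delta> L)" for r
    unfolding \<open>\<delta> = lam - t\<^sub>U\<close> \<open>L = t\<^sub>U - t\<^sub>L\<close> by (intro J_int_eq_sum_H_int bounds)
  show "(\<lambda>y. y ^ s * (\<delta> + y) powr (-\<alpha>)) absolutely_integrable_on {0..L}" for s
    by (intro absolutely_integrable_power_mult_powr bounds)
  show "H_int \<alpha> s 0 L = L powr (real s + 1 - \<alpha>) / (real s + 1 - \<alpha>)" for s
    by (intro H_int_0 bounds)
  show "H_int \<alpha> s \<delta> L = (\<Sum>r\<le>s. real (s choose r) * (-\<delta>) ^ (s - r) *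
      (((\<delta> + L) powr (real r + 1 - \<alpha>) - \<delta> powr (real r + 1 - \<alpha>)) / (real r + 1 - \<alpha>)))" for s
    by (intro H_int_nonneg bounds)
qed

end
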